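(* Let $X$ be a $W$-hyperbolic space, $C\subseteq X$ a convex subset, $T:C\to C$ a nonexpansive mapping with $\operatorname{Fix}(T)\neq\emptyset$, $\rho\in[0,1)$, and $f:C\to C$ a $\rho$-contraction. Let $J=2\left\lceil\frac{1}{1-\rho}\right\rceil$ and $\alpha_n=1-\frac{2}{(1-\rho)(n+J)}$ for all $n\in\mathbb{N}$. Let $x\in C$ and let $(x_n)$ be defined by $$x_0=x,\qquad x_{n+1}=(1-\alpha_n)f(x_n)+\alpha_nTx_n\quad(n\in\mathbb{N}).$$ Let $p$ be a fixed point of $T$ and $M\in\mathbb{N}^*$ be such that $M\ge\max\left\{d(x,p),\frac{d(p,f(p))}{1-\rho}\right\}$. Then for all $n\in\mathbb{N}$, $$d(x_{n+1},x_n)\le\frac{2MJ}{(1-\rho)(n+J)},\qquad d(Tx_n,x_n)\le\frac{2M(J+2)}{(1-\rho)(n+J)}.$$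
   Context: $\mathbb{N}=\{0,1,2,\dots\}$ and $\mathbb{N}^*=\mathbb{N}\setminus\{0\}$. A $W$-hyperbolic space is a metric space $(X,d)$ together with a function $W:X\times X\times[0,1]\to X$, where one writes $(1-\lambda)x+\lambda y$ for $W(x,y,\lambda)$, such that for all $x,y,z,w\in X$ and $\lambda,\tilde\lambda\in[0,1]$: (W1) $d(z,W(x,y,\lambda))\le(1-\lambda)d(z,x)+\lambda d(z,y)$; (W2) $d(W(x,y,\lambda),W(x,y,\tilde\lambda))=|\lambda-\tilde\lambda|d(x,y)$; (W3) $W(x,y,\lambda)=W(y,x,1-\lambda)$; (W4) $d(W(x,z,\lambda),W(y,w,\lambda))\le(1-\lambda)d(x,y)+\lambda d(z,w)$. A nonempty subset $C\subseteq X$ is convex if $(1-\lambda)x+\lambda y\in C$ for all $x,y\in C$ and $\lambda\in[0,1]$. $T:C\to C$ is nonexpansive if $d(Tx,Ty)\le d(x,y)$ for all $x,y\in C$; $\operatorname{Fix}(T)$ is the set of fixed points of $T$. $f:C\to C$ is a $\rho$-contraction if $d(f(x),f(y))\le\rho\, d(x,y)$ for all $x,y\in C$. *)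

theory Defs
  imports "HOL-Analysis.Abstract_Metric_Spaces"
begin

text \<open>
  \<open>W x y l\<close> plays the role of \<open>(1 - l) x + l y\<close>. Its values are only constrained for points of the
  carrier and \<open>l \<in> {0..1}\<close>.
\<close>

locale W_hyperbolic_space = Metric_space X d
  for X :: "'a set" and d :: "'a \<Rightarrow> 'a \<Rightarrow> real" +
  fixes W :: "'a \<Rightarrow> 'a \<Rightarrow> real \<Rightarrow> 'a"
  assumes W_closed: "\<lbrakk>x \<in> X; y \<in> X; l \<in> {0..1}\<rbrakk> \<Longrightarrow> W x y l \<in> X"
    and W1: "\<lbrakk>x \<in> X; y \<in> X; z \<in> X; l \<in> {0..1}\<rbrakk>
      \<Longrightarrow> d z (W x y l) \<le> (1 - l) * d z x + l * d z y"
    and W2: "\<lbrakk>x \<in> X; y \<in> X; l \<in> {0..1}; m \<in> {0..1}\<rbrakk>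
      \<Longrightarrow> d (W x y l) (W x y m) = \<bar>l - m\<bar> * d x y"
    and W3: "\<lbrakk>x \<in> X; y \<in> X; l \<in> {0..1}\<rbrakk> \<Longrightarrow> W x y l = W y x (1 - l)"
    and W4: "\<lbrakk>x \<in> X; y \<in> X; z \<in> X; w \<in> X; l \<in> {0..1}\<rbrakk>
      \<Longrightarrow> d (W x z l) (W y w l) \<le> (1 - l) * d x y + l * d z w"

definition W_convex :: "'a set \<Rightarrow> ('a \<Rightarrow> 'a \<Rightarrow> real \<Rightarrow> 'a) \<Rightarrow> 'a set \<Rightarrow> bool" where
  "W_convex X W C \<longleftrightarrow>
    C \<noteq> {} \<and> C \<subseteq> X \<and> (\<forall>x\<in>C. \<forall>y\<in>C. \<forall>l\<in>{0..1}. W x y l \<in> C)"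

definition nonexpansive_on :: "'a set \<Rightarrow> ('a \<Rightarrow> 'a \<Rightarrow> real) \<Rightarrow> ('a \<Rightarrow> 'a) \<Rightarrow> bool" where
  "nonexpansive_on C d T \<longleftrightarrow> T \<in> C \<rightarrow> C \<and> (\<forall>x\<in>C. \<forall>y\<in>C. d (T x) (T y) \<le> d x y)"

definition contraction_on :: "real \<Rightarrow> 'a set \<Rightarrow> ('a \<Rightarrow> 'a \<Rightarrow> real) \<Rightarrow> ('a \<Rightarrow> 'a) \<Rightarrow> bool" where
  "contraction_on \<rho> C d f \<longleftrightarrow> f \<in> C \<rightarrow> C \<and> (\<forall>x\<in>C. \<forall>y\<in>C. d (f x) (f y) \<le> \<rho> * d x y)"

definition Fix_on :: "'a set \<Rightarrow> ('a \<Rightarrow> 'a) \<Rightarrow> 'a set" where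
  "Fix_on C T = {x \<in> C. T x = x}"

end

theory Submission
  imports Defs
begin

text \<open>
  All iterates stay within distance \<open>M\<close> of \<open>p\<close>, so \<open>d (f x\<^sub>n) (T x\<^sub>n) \<le> 2 M\<close>. Comparing
  consecutive steps via (W4) and (W2), with \<open>1 - (1 - \<rho>) (1 - \<alpha>\<^sub>n) = 1 - 2 / (n + J)\<close>, gives
  \<open>d x\<^sub>n\<^sub>+\<^sub>1 x\<^sub>n \<le> (1 - 2 / (n + J)) d x\<^sub>n x\<^sub>n\<^sub>-\<^sub>1 + 4 M / ((1 - \<rho>) (n + J) (n + J - 1))\<close>,
  and the bound \<open>2 M J / ((1 - \<rho>) (n + J))\<close> is propagated by this recursion because \<open>J \<ge> 2\<close>.
  Asymptotic regularity of \<open>T\<close> follows from \<open>d (T x\<^sub>n) x\<^sub>n\<^sub>+\<^sub>1 \<le> (1 - \<alpha>\<^sub>n) d (T x\<^sub>n) (f x\<^sub>n)\<close>.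
\<close>

text \<open>Collects the estimates valid for any parameters in [0,1]; the explicit formula for
  \<alpha> enters only when the locale is interpreted. \<open>M_fixpoint\<close> is the bound on
  \<open>d p (f p) / (1 - \<rho>)\<close> with the division cleared.\<close>

locale viscosity_iteration = W_hyperbolic_space X d W
  for X :: "'a set" and d W +
  fixes C :: "'a set" and T f :: "'a \<Rightarrow> 'a" and \<rho> :: real
    and \<alpha> :: "nat \<Rightarrow> real" and xs :: "nat \<Rightarrow> 'a" and p :: 'a and M :: real
  assumes convex: "W_convex X W C"
    and nonexpansive: "nonexpansive_on C d T"
    and rho: "0 \<le> \<rho>" "\<rho> < 1"
    and contraction: "contraction_on \<rho> C d f"
    and alpha: "\<alpha> n \<in> {0..1}"
    and start: "xs 0 \<in> C"
    and step: "xs (Suc n) = W (f (xs n)) (T (xs n)) (\<alpha> n)"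
    and fixpoint: "p \<in> Fix_on C T"
    and M_start: "d (xs 0) p \<le> M"
    and M_fixpoint: "d p (f p) \<le> (1 - \<rho>) * M"
begin

lemma C_subset: "y \<in> C \<Longrightarrow> y \<in> X"
  using convex by (auto simp: W_convex_def)

lemma T_closed: "y \<in> C \<Longrightarrow> T y \<in> C" and T_le: "y \<in> C \<Longrightarrow> z \<in> C \<Longrightarrow> d (T y) (T z) \<le> d y z"
  using nonexpansive by (auto simp: nonexpansive_on_def)

lemma f_closed: "y \<in> C \<Longrightarrow> f y \<in> C" and f_le: "y \<in> C \<Longrightarrow> z \<in> C \<Longrightarrow> d (f y) (f z) \<le> \<rho> * d y z"
  using contraction by (auto simp: contraction_on_def)

lemma p_closed: "p \<in> C" and T_p: "T p = p"
  using fixpoint by (auto simp: Fix_on_def)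

lemma iterate_closed: "xs n \<in> C"
proof (induction n)
  case 0
  show ?case by (rule start)
next
  case (Suc n)
  then show ?case
    using convex alpha[of n] T_closed f_closed by (auto simp: step W_convex_def)
qed

lemmas closed [simp] =
  p_closed iterate_closed T_closed[OF iterate_closed] f_closed[OF iterate_closed]
  f_closed[OF p_closed] C_subset[OF p_closed] C_subset[OF iterate_closed]
  C_subset[OF T_closed[OF iterate_closed]] C_subset[OF f_closed[OF iterate_closed]]
  C_subset[OF f_closed[OF p_closed]]

text \<open>The radius splits as \<open>M = (1 - \<rho>) * M + \<rho> * M\<close>: the first part
  pays for \<open>f\<close> moving \<open>p\<close>, the second for the contracted distance to
  \<open>p\<close>. The bound on \<open>xs n\<close> is a premise so that the lemma can serve inside
  the induction for \<open>iterate_bounded\<close>.\<close>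

lemma dist_f_fixpoint_le:
  assumes "d (xs n) p \<le> M"
  shows "d p (f (xs n)) \<le> M"
proof -
  have "d p (f (xs n)) \<le> d p (f p) + d (f p) (f (xs n))"
    by (rule triangle) simp_all
  also have "d (f p) (f (xs n)) \<le> \<rho> * d p (xs n)"
    by (rule f_le) simp_all
  also have "\<dots> \<le> \<rho> * M"
    using assms rho by (simp add: commute mult_left_mono)
  also have "d p (f p) \<le> (1 - \<rho>) * M" by (rule M_fixpoint)
  finally show ?thesis by (simp add: algebra_simps)
qed

lemma dist_T_fixpoint_le: "d p (T (xs n)) \<le> d (xs n) p"
  using T_le[OF p_closed iterate_closed[of n]] by (simp add: T_p commute)

text \<open>By (W1) closed balls around \<open>p\<close> are convex, and each new iterate lies
  between two points of the ball of radius \<open>M\<close>.\<close>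

lemma iterate_bounded: "d (xs n) p \<le> M"
proof (induction n)
  case 0
  show ?case by (rule M_start)
next
  case (Suc n)
  have "d p (xs (Suc n)) \<le> (1 - \<alpha> n) * d p (f (xs n)) + \<alpha> n * d p (T (xs n))"
    unfolding step by (rule W1) (use alpha in simp_all)
  also have "\<dots> \<le> (1 - \<alpha> n) * M + \<alpha> n * M"
    using alpha[of n] dist_f_fixpoint_le[OF Suc] dist_T_fixpoint_le[of n] Suc
    by (intro add_mono mult_left_mono) auto
  finally show ?case by (simp add: algebra_simps commute)
qed

lemma dist_f_T_le: "d (f (xs n)) (T (xs n)) \<le> 2 * M"
  using triangle[of "f (xs n)" p "T (xs n)"] dist_f_fixpoint_le[OF iterate_bounded, of n]
    dist_T_fixpoint_le[of n] iterate_bounded[of n]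
  by (simp add: commute)

lemma consecutive_dist_le: "d (xs (Suc n)) (xs n) \<le> 2 * M"
  using triangle[of "xs (Suc n)" p "xs n"] iterate_bounded[of n] iterate_bounded[of "Suc n"]
  by (simp add: commute)

lemma consecutive_dist_step:
  "d (xs (Suc (Suc n))) (xs (Suc n))
    \<le> (1 - (1 - \<rho>) * (1 - \<alpha> (Suc n))) * d (xs (Suc n)) (xs n) + 2 * M * \<bar>\<alpha> (Suc n) - \<alpha> n\<bar>"
proof -
  let ?a = "\<alpha> (Suc n)" and ?D = "d (xs (Suc n)) (xs n)"
  \<comment> \<open>Old endpoints with the new parameter: (W4) then compares points with equal
    parameters, (W2) points with equal endpoints.\<close>
  let ?y = "W (f (xs n)) (T (xs n)) ?a"
  have "d (xs (Suc (Suc n))) (xs (Suc n)) \<le> d (xs (Suc (Suc n))) ?y + d ?y (xs (Suc n))"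
    by (rule triangle) (use alpha W_closed in simp_all)
  also have "d (xs (Suc (Suc n))) ?y
      \<le> (1 - ?a) * d (f (xs (Suc n))) (f (xs n)) + ?a * d (T (xs (Suc n))) (T (xs n))"
    unfolding step[of "Suc n"] by (rule W4) (use alpha in simp_all)
  also have "\<dots> \<le> (1 - ?a) * (\<rho> * ?D) + ?a * ?D"
    using alpha[of "Suc n"] by (intro add_mono mult_left_mono f_le T_le) auto
  also have "d ?y (xs (Suc n)) = \<bar>?a - \<alpha> n\<bar> * d (f (xs n)) (T (xs n))"
    unfolding step[of n] by (rule W2) (use alpha in simp_all)
  also have "\<dots> \<le> \<bar>?a - \<alpha> n\<bar> * (2 * M)"
    by (intro mult_left_mono dist_f_T_le) simp
  finally show ?thesis by (simp add: algebra_simps)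
qed

lemma dist_T_iterate_le: "d (T (xs n)) (xs n) \<le> d (xs (Suc n)) (xs n) + 2 * M * (1 - \<alpha> n)"
proof -
  \<comment> \<open>(W1) is applied from the endpoint \<open>T (xs n)\<close> itself, so the term
    with weight \<open>\<alpha> n\<close> is zero.\<close>
  have "d (T (xs n)) (xs (Suc n))
      \<le> (1 - \<alpha> n) * d (T (xs n)) (f (xs n)) + \<alpha> n * d (T (xs n)) (T (xs n))"
    unfolding step by (rule W1) (use alpha in simp_all)
  also have "\<dots> \<le> (1 - \<alpha> n) * (2 * M)"
    using alpha[of n] dist_f_T_le[of n] by (simp add: commute mult_left_mono)
  finally show ?thesis
    using triangle[of "T (xs n)" "xs (Suc n)" "xs n"] by (simp add: mult.commute)
qed

end

text \<open>The purely real part of the argument, applied with \<open>K\<close> = M / (1 - \<rho>)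
  and \<open>s n\<close> the distance of consecutive iterates.\<close>

lemma recursive_rate:
  fixes s :: "nat \<Rightarrow> real" and J K :: real
  assumes "J \<ge> 2" and "K \<ge> 0" and "s 0 \<le> 2 * K"
    and step: "\<And>n. s (Suc n) \<le> (1 - 2 / (real (Suc n) + J)) * s n
      + 4 * K / ((real (Suc n) + J) * (real n + J))"
  shows "s n \<le> 2 * K * J / (real n + J)"
proof (induction n)
  case 0
  then show ?case using assms by simp
next
  case (Suc n)
  define t where "t = real n + J"
  have t: "t \<ge> 2" "real (Suc n) + J = t + 1" using assms by (auto simp: t_def)
  have "s (Suc n) \<le> (1 - 2 / (t + 1)) * s n + 4 * K / ((t + 1) * t)"
    using step[of n] by (simp only: t t_def[symmetric])
  \<comment> \<open>The induction hypothesis may be multiplied in because \<open>t \<ge> 2\<close>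
    makes the factor nonnegative.\<close>
  also have "\<dots> \<le> (1 - 2 / (t + 1)) * (2 * K * J / t) + 4 * K / ((t + 1) * t)"
    using Suc t by (intro add_mono mult_left_mono) (auto simp: t_def)
  also have "\<dots> = 2 * K * (J * (t - 1) + 2) / ((t + 1) * t)"
    using t(1) by (simp add: divide_simps) (simp add: algebra_simps)
  \<comment> \<open>J (t - 1) + 2 \<le> J t is exactly J \<ge> 2.\<close>
  also have "\<dots> \<le> 2 * K * (J * t) / ((t + 1) * t)"
    using assms t(1) by (intro divide_right_mono mult_left_mono) (auto simp: algebra_simps)
  also have "\<dots> = 2 * K * J / (real (Suc n) + J)"
    unfolding t(2) using t(1) by simp
  finally show ?case .
qed

theorem proposition3p3:
  fixes X C :: "'a set"
    and d :: "'a \<Rightarrow> 'a \<Rightarrow> real"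
    and W :: "'a \<Rightarrow> 'a \<Rightarrow> real \<Rightarrow> 'a"
    and T f :: "'a \<Rightarrow> 'a"
    and \<rho> :: real
    and J :: int
    and \<alpha> :: "nat \<Rightarrow> real"
    and x p :: 'a
    and xs :: "nat \<Rightarrow> 'a"
    and M :: nat
  assumes "W_hyperbolic_space X d W"
    and "W_convex X W C"
    and "nonexpansive_on C d T"
    and "Fix_on C T \<noteq> {}"
    and "0 \<le> \<rho>" and "\<rho> < 1"
    and "contraction_on \<rho> C d f"
    and "J = 2 * \<lceil>1 / (1 - \<rho>)\<rceil>"
    and "\<And>n. \<alpha> n = 1 - 2 / ((1 - \<rho>) * (real n + real_of_int J))"
    and "x \<in> C"
    and "xs 0 = x"
    and "\<And>n. xs (Suc n) = W (f (xs n)) (T (xs n)) (\<alpha> n)"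
    and "p \<in> Fix_on C T"
    and "M \<ge> 1"
    and "real M \<ge> max (d x p) (d p (f p) / (1 - \<rho>))"
  shows "\<forall>n. d (xs (Suc n)) (xs n)
              \<le> 2 * real M * real_of_int J / ((1 - \<rho>) * (real n + real_of_int J))
           \<and> d (T (xs n)) (xs n)
              \<le> 2 * real M * (real_of_int J + 2) / ((1 - \<rho>) * (real n + real_of_int J))"
proof
  fix n
  define j where "j = real_of_int J"
  define K where "K = real M / (1 - \<rho>)"
  have rho: "0 < 1 - \<rho>" using assms by simp
  have "1 / (1 - \<rho>) \<le> real_of_int \<lceil>1 / (1 - \<rho>)\<rceil>" by (rule le_of_int_ceiling)
  then have "2 * (1 / (1 - \<rho>)) \<le> 2 * real_of_int \<lceil>1 / (1 - \<rho>)\<rceil>" by (rule mult_left_mono) simp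
  then have j: "2 / (1 - \<rho>) \<le> j" unfolding j_def assms(8) by simp
  \<comment> \<open>This makes \<open>\<alpha> k\<close> nonnegative from k = 0 on; it is the reason
    for the ceiling in \<open>J\<close>.\<close>
  then have j': "2 \<le> (1 - \<rho>) * j" using rho by (simp add: field_simps)
  have "1 \<le> 1 / (1 - \<rho>)" using assms(5,6) by simp
  then have j2: "2 \<le> j" using j by simp
  have K: "0 \<le> K" "real M \<le> K"
    using rho assms(5) mult_left_le[of "1 - \<rho>" "real M"] by (auto simp: K_def field_simps)
  have alpha_eq: "\<alpha> k = 1 - 2 / ((1 - \<rho>) * (real k + j))" for k
    by (simp add: assms(9) j_def)
  have "\<alpha> k \<in> {0..1}" for k
  proof -
    have "2 \<le> (1 - \<rho>) * (real k + j)"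
      using j' rho by (simp add: distrib_left add_increasing)
    then show ?thesis by (simp add: alpha_eq)
  qed
  moreover have "d p (f p) \<le> (1 - \<rho>) * real M"
    using assms(15) rho by (simp add: field_simps)
  ultimately interpret viscosity_iteration X d W C T f \<rho> \<alpha> xs p "real M"
    using assms by (intro viscosity_iteration.intro viscosity_iteration_axioms.intro) simp_all
  have rate: "d (xs (Suc n)) (xs n) \<le> 2 * K * j / (real n + j)"
  proof (rule recursive_rate[OF j2 K(1)])
    show "d (xs (Suc 0)) (xs 0) \<le> 2 * K"
      using consecutive_dist_le[of 0] K(2) by simp
  next
    fix k
    define t where "t = real k + j"
    have t: "t > 0" "real (Suc k) + j = t + 1" using j2 by (auto simp: t_def)
    \<comment> \<open>The identity 1/t - 1/(t + 1) = 1/(t (t + 1)) produces the quadratically small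
      error term.\<close>
    have "\<alpha> (Suc k) - \<alpha> k = 2 / ((1 - \<rho>) * t) - 2 / ((1 - \<rho>) * (t + 1))"
      unfolding alpha_eq t by (simp add: t_def)
    also have "\<dots> = 2 / ((1 - \<rho>) * ((t + 1) * t))"
      using t(1) rho by (simp add: divide_simps)
    finally have "2 * real M * \<bar>\<alpha> (Suc k) - \<alpha> k\<bar> = 4 * K / ((t + 1) * t)"
      using t(1) rho by (simp add: K_def)
    \<comment> \<open>The factor 1 - \<rho> in the denominator of \<alpha> cancels here, leaving a
      recursion coefficient free of \<rho>.\<close>
    moreover have "(1 - \<rho>) * (1 - \<alpha> (Suc k)) = 2 / (t + 1)"
      unfolding alpha_eq t using rho(2) t(1) by (simp add: divide_simps)
    ultimately show "d (xs (Suc (Suc k))) (xs (Suc k))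
        \<le> (1 - 2 / (real (Suc k) + j)) * d (xs (Suc k)) (xs k)
          + 4 * K / ((real (Suc k) + j) * (real k + j))"
      using consecutive_dist_step[of k] unfolding t by (simp add: t_def)
  qed
  \<comment> \<open>Written as 2 K * 2, this extra term turns the \<open>j\<close> of the first rate
    into \<open>j + 2\<close>.\<close>
  moreover have "2 * real M * (1 - \<alpha> n) = 4 * K / (real n + j)"
    by (simp add: alpha_eq K_def)
  ultimately have "d (T (xs n)) (xs n) \<le> 2 * K * (j + 2) / (real n + j)"
    using dist_T_iterate_le[of n] by (simp add: add_divide_distrib distrib_left)
  with rate show "d (xs (Suc n)) (xs n)
        \<le> 2 * real M * real_of_int J / ((1 - \<rho>) * (real n + real_of_int J))
      \<and> d (T (xs n)) (xs n)
        \<le> 2 * real M * (real_of_int J + 2) / ((1 - \<rho>) * (real n + real_of_int J))"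
    by (simp add: K_def j_def)
qed

end
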